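(* In each of the three channel cases (Case 1, Case 2, Case 3) described in the context, the following hold. (1) There exists a unique $s^\star$ minimizing $\mathcal{E}(s)$ over $s\ge 0$, and it satisfies $P'(s^\star)=\dfrac{P(s^\star)}{s^\star}$. (2) $\mathcal{E}(s)$ is strictly decreasing in $s\in(0,s^\star]$, and $P'(s)<\dfrac{P(s)}{s}$ for all $s\in(0,s^\star)$. (3) $\mathcal{E}(s)$ is strictly increasing in $s\in[s^\star,+\infty)$, and $P'(s)>\dfrac{P(s)}{s}$ for all $s\in(s^\star,+\infty)$.
   Context: Constants: bandwidth $B>0$, noise variance $\sigma^2>0$, power-amplifier efficiency $\xi>0$, rate-independent circuit power $P_c>0$, coefficient $\kappa\ge 0$. The function $\phi:[0,\infty)\to\mathbb{R}$ satisfies $\phi(0)=0$ and is differentiable, strictly increasing and (not necessarily strictly) convex on $[0,\infty)$. The function $\rho(s)$, $s\ge 0$ (minimum transmission power needed to achieve spectral efficiency $s$, divided by $\sigma^2$) is defined in three cases. Case 1 (static channel, transmitter knows the channel): $G>0$ is a constant and $\rho(s)=\min\{p\ge0:\log_2(1+Gp)\ge s\}=\frac1G(2^s-1)$. Case 2 (fast-varying channel, transmitter knows its distribution): $G\ge0$ is a random variable with a probability density function and $\rho(s)=\min\{p\ge 0:\mathbb{E}_G[\log_2(1+Gp)]\ge s\}$. Case 3 (fast-varying channel, transmitter knows the channel): $G$ is a random variable as in Case 2 and $\rho(s)=\min \mathbb{E}_G[p(G)]$ over all nonnegative (measurable) functions $p(\cdot)$ on $[0,\infty)$ satisfying $\mathbb{E}_G[\log_2(1+Gp(G))]\ge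 s$. In Cases 2 and 3, $\mathbb{E}_G[\log_2(1+Gp)]<\infty$ for every constant $p\ge0$. Minimum total power: $P(s)=\kappa\phi(Bs)+\frac{\sigma^2}{\xi}\rho(s)+P_c$. Energy per bit (the energy efficiency; smaller is better): $\mathcal{E}(s)=\frac{P(s)}{Bs}$ for $s>0$, with $\mathcal{E}(0)=+\infty$. A prime denotes the derivative with respect to the argument. *)

theory Defs
  imports "HOL-Probability.Probability"
begin

text \<open>
  The minimum transmission power, divided by the noise variance, needed to achieve the spectral
  efficiency \<open>s \<ge> 0\<close>. Each minimum is rendered by \<open>LEAST\<close>, not by an infimum: nothing is known
  about its value until it has been shown to be attained.
\<close>

definition rho_static :: "real \<Rightarrow> real \<Rightarrow> real" where
  "rho_static G s = (LEAST p. 0 \<le> p \<and> s \<le> log 2 (1 + G * p))"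

lemma rho_static_closed_form:
  assumes "0 < G" "0 \<le> s"
  shows "rho_static G s = (2 powr s - 1) / G"
  unfolding rho_static_def
proof (rule Least_equality)
  show "0 \<le> (2 powr s - 1) / G \<and> s \<le> log 2 (1 + G * ((2 powr s - 1) / G))"
    using assms by (simp add: ge_one_powr_ge_zero)
next
  fix p :: real
  assume p: "0 \<le> p \<and> s \<le> log 2 (1 + G * p)"
  have "0 < 1 + G * p"
    using assms p by (simp add: add_pos_nonneg)
  then have "2 powr s \<le> 1 + G * p"
    using p by (simp add: le_log_iff)
  then show "(2 powr s - 1) / G \<le> p"
    using assms by (simp add: field_simps)
qed

text \<open>
  Since the integrand is nonnegative, finiteness of its expectation is integrability.
\<close>

definition fading_channel :: "'a measure \<Rightarrow> ('a \<Rightarrow> real) \<Rightarrow> bool" where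
  "fading_channel M G \<longleftrightarrow>
     prob_space M \<and>
     (\<forall>\<omega>\<in>space M. 0 \<le> G \<omega>) \<and>
     (\<exists>f. distributed M lborel G f) \<and>
     (\<forall>p\<ge>0. integrable M (\<lambda>\<omega>. log 2 (1 + G \<omega> * p)))"

definition rho_known_distribution :: "'a measure \<Rightarrow> ('a \<Rightarrow> real) \<Rightarrow> real \<Rightarrow> real" where
  "rho_known_distribution M G s =
     (LEAST p. 0 \<le> p \<and> s \<le> prob_space.expectation M (\<lambda>\<omega>. log 2 (1 + G \<omega> * p)))"

text \<open>
  For a power \<open>p\<close> depending on the channel gain, both expectations may be infinite, so they are taken in \<open>ennreal\<close>;
  with the Bochner integral, an infinite expectation would be read as \<open>0\<close>.
\<close>

definition rho_known_channel :: "'a measure \<Rightarrow> ('a \<Rightarrow> real) \<Rightarrow> real \<Rightarrow> real" where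
  "rho_known_channel M G s = enn2real (LEAST e.
     \<exists>p \<in> borel_measurable (restrict_space borel {0..}).
       (\<forall>g\<ge>0. 0 \<le> p g) \<and>
       ennreal s \<le> (\<integral>\<^sup>+\<omega>. ennreal (log 2 (1 + G \<omega> * p (G \<omega>))) \<partial>M) \<and>
       e = (\<integral>\<^sup>+\<omega>. ennreal (p (G \<omega>)) \<partial>M))"

definition total_power ::
  "real \<Rightarrow> (real \<Rightarrow> real) \<Rightarrow> real \<Rightarrow> real \<Rightarrow> real \<Rightarrow> (real \<Rightarrow> real) \<Rightarrow> real \<Rightarrow> real \<Rightarrow> real" where
  "total_power \<kappa> \<phi> B \<sigma>2 \<xi> \<rho> Pc s = \<kappa> * \<phi> (B * s) + \<sigma>2 / \<xi> * \<rho> s + Pc"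

definition energy_per_bit :: "real \<Rightarrow> (real \<Rightarrow> real) \<Rightarrow> real \<Rightarrow> ereal" where
  "energy_per_bit B P s = (if s = 0 then \<infinity> else ereal (P s / (B * s)))"

end

theory Submission
  imports Defs
begin

text \<open>
  Where \<open>F s = s * P' s - P s\<close> is negative, the energy per bit decreases, and where it is positive,
  it increases. If \<open>P'\<close> is strictly increasing and unbounded and \<open>P\<close> is bounded below by a positive
  constant, then \<open>F\<close> is strictly increasing and the energy per bit attains its minimum, at the zero
  of \<open>F\<close>. It remains to see that \<open>\<rho>\<close> has a strictly increasing unbounded derivative. No derivative is
  taken under an expectation: in each case \<open>\<rho>\<close> is given by a curve \<open>u \<mapsto> (S u, C u)\<close> of achieved rate
  and spent power (\<open>u\<close> is the constant power, or the water level if the transmitter knows the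
  channel), and integrating a pointwise tangent inequality yields a slope \<open>\<mu> u\<close> with
  \<open>C v \<ge> C u + \<mu> u * (S v - S u)\<close>. A subgradient that is continuous is a derivative.
\<close>

section \<open>Convex functions with unbounded slope\<close>

definition superlinear_convex :: "(real \<Rightarrow> real) \<Rightarrow> bool" where
  "superlinear_convex f \<longleftrightarrow>
     (\<exists>f'. (\<forall>s>0. 0 \<le> f s \<and> (f has_real_derivative f' s) (at s)) \<and>
           strict_mono_on {0<..} f' \<and> (\<forall>K. \<exists>s>0. K < f' s))"

text \<open>The tangent inequalities at \<open>s\<close> and at \<open>t\<close> trap the difference
  quotient between \<open>m s\<close> and \<open>m t\<close>, and these merge as \<open>t\<close>
  tends to \<open>s\<close>.\<close>

lemma has_real_derivative_continuous_subgradient: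
  fixes f m :: "real \<Rightarrow> real"
  assumes "open A" "s \<in> A"
    and tangent: "\<And>u v. u \<in> A \<Longrightarrow> v \<in> A \<Longrightarrow> f u + m u * (v - u) \<le> f v"
    and cont: "continuous_on A m"
  shows "(f has_real_derivative m s) (at s)"
proof -
  have "(m \<longlongrightarrow> m s) (at s)"
    using assms by (metis at_within_open continuous_on_def)
  then have lim: "((\<lambda>t. \<bar>m t - m s\<bar>) \<longlongrightarrow> 0) (at s)"
    by (simp add: LIM_zero tendsto_rabs_zero)
  have bound: "\<bar>(f t - f s) / (t - s) - m s\<bar> \<le> \<bar>m t - m s\<bar>" if "t \<in> A" "t \<noteq> s" for t
  proof -
    have lower: "m s * (t - s) \<le> f t - f s" and upper: "f t - f s \<le> m t * (t - s)"
      using tangent[of s t] tangent[of t s] that assms(2) by (auto simp: algebra_simps)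
    have "s < t \<or> t < s" using that by auto
    then show ?thesis
    proof
      assume "s < t"
      then have "m s \<le> (f t - f s) / (t - s)" "(f t - f s) / (t - s) \<le> m t"
        using lower upper by (simp_all add: field_simps)
      then show ?thesis by linarith
    next
      assume "t < s"
      then have "m t \<le> (f t - f s) / (t - s)" "(f t - f s) / (t - s) \<le> m s"
        using lower upper by (simp_all add: pos_le_divide_eq neg_le_divide_eq neg_divide_le_eq)
      then show ?thesis by linarith
    qed
  qed
  have ev: "\<forall>\<^sub>F t in at s. t \<in> A \<and> t \<noteq> s"
    using assms(1,2) by (auto simp: eventually_at_topological)
  have "((\<lambda>t. (f t - f s) / (t - s) - m s) \<longlongrightarrow> 0) (at s)"
    by (rule tendsto_rabs_zero_cancel, rule tendsto_sandwich[OF _ _ tendsto_const lim])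
      (use ev in \<open>auto elim!: eventually_mono simp: bound\<close>)
  then show ?thesis
    unfolding has_field_derivative_iff by (simp add: LIM_zero_iff)
qed

text \<open>\<open>S\<close> is inverted on the positive rates by \<open>U\<close>; then
  \<open>\<rho>\<close> is \<open>C\<close> composed with \<open>U\<close>, and \<open>\<mu>\<close>
  composed with \<open>U\<close> is a continuous subgradient of it. Strict growth of
  \<open>S\<close> is asked only where \<open>S\<close> is positive, since the water-filling rate
  can vanish for all low water levels.\<close>

lemma superlinear_convex_parametric:
  fixes S C \<mu> \<rho> :: "real \<Rightarrow> real"
  assumes cont: "continuous_on {0<..} S" "continuous_on {0<..} \<mu>"
    and S_less: "\<And>u v. 0 < u \<Longrightarrow> u < v \<Longrightarrow> 0 < S u \<Longrightarrow> S u < S v"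
    and surj: "\<And>s. 0 < s \<Longrightarrow> \<exists>u>0. S u = s"
    and val: "\<And>u. 0 < u \<Longrightarrow> 0 < S u \<Longrightarrow> \<rho> (S u) = C u"
    and C_nonneg: "\<And>u. 0 < u \<Longrightarrow> 0 \<le> C u"
    and tangent: "\<And>u v. 0 < u \<Longrightarrow> 0 < v \<Longrightarrow> C u + \<mu> u * (S v - S u) \<le> C v"
    and \<mu>_less: "\<And>u v. 0 < u \<Longrightarrow> u < v \<Longrightarrow> \<mu> u < \<mu> v"
    and unbounded: "\<And>K. \<exists>u>0. 0 < S u \<and> K < \<mu> u"
  shows "superlinear_convex \<rho>"
proof -
  obtain U where U: "\<And>s. 0 < s \<Longrightarrow> 0 < U s \<and> S (U s) = s"
    using surj by metis
  have US: "U (S u) = u" if "0 < u" "0 < S u" for u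
    using U[OF that(2)] S_less[of u "U (S u)"] S_less[of "U (S u)" u] that
    by (cases "U (S u)" u rule: linorder_cases) auto
  have U_less: "U s < U t" if "0 < s" "s < t" for s t
    using U[of s] U[of t] S_less[of "U t" "U s"] that by (cases "U s" "U t" rule: linorder_cases) auto
  \<comment> \<open>The range of \<open>U\<close> is thus an open set, a preimage under the
    continuous \<open>S\<close>; a monotone map with open range has no jumps, so \<open>U\<close> is
    continuous.\<close>
  have image: "U ` {0<..} = {0<..} \<inter> S -` {0<..}"
  proof (intro equalityI subsetI)
    show "u \<in> U ` {0<..}" if "u \<in> {0<..} \<inter> S -` {0<..}" for u
      using that US[of u] by (auto intro!: image_eqI[of _ _ "S u"])
  qed (use U in auto)
  have "open (U ` {0<..})"
    unfolding image using cont(1) by (intro continuous_open_preimage) auto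
  then have "continuous_on {0<..} U"
    using U_less by (intro continuous_onI_mono) (auto simp: le_less)
  then have cont_\<mu>U: "continuous_on {0<..} (\<lambda>s. \<mu> (U s))"
    by (rule continuous_on_compose2[OF cont(2)]) (use U in auto)
  have \<rho>: "\<rho> s = C (U s)" if "0 < s" for s
    using U[OF that] val[of "U s"] that by simp
  have "(\<rho> has_real_derivative \<mu> (U s)) (at s)" if "0 < s" for s
  proof (rule has_real_derivative_continuous_subgradient[where A = "{0<..}"])
    show "\<rho> u + \<mu> (U u) * (v - u) \<le> \<rho> v" if "u \<in> {0<..}" "v \<in> {0<..}" for u v
      using that tangent[of "U u" "U v"] U[of u] U[of v] by (simp add: \<rho>)
  qed (use that cont_\<mu>U in auto)
  moreover have "strict_mono_on {0<..} (\<lambda>s. \<mu> (U s))"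
    using U U_less \<mu>_less by (auto intro!: strict_mono_onI)
  moreover have "\<exists>s>0. K < \<mu> (U s)" for K
    using unbounded[of K] US by force
  ultimately show ?thesis
    unfolding superlinear_convex_def using \<rho> U C_nonneg
    by (intro exI[of _ "\<lambda>s. \<mu> (U s)"]) auto
qed

text \<open>The term with \<open>\<phi>\<close> contributes a nonnegative, nondecreasing derivative,
  so strict growth and unboundedness of the slope are inherited from \<open>\<rho>\<close>. The
  circuit power is set to 0 here and returns as the constant \<open>c\<close> of
  \<open>energy_per_bit_minimization\<close>.\<close>

lemma superlinear_convex_total_power:
  assumes "0 < B" "0 < \<sigma>2" "0 < \<xi>" "0 \<le> \<kappa>"
    and \<phi>: "\<phi> 0 = 0" "\<phi> differentiable_on {0..}" "strict_mono_on {0..} \<phi>" "convex_on {0..} \<phi>"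
    and \<rho>: "superlinear_convex \<rho>"
  shows "superlinear_convex (total_power \<kappa> \<phi> B \<sigma>2 \<xi> \<rho> 0)"
proof -
  define d where "d = deriv \<phi>"
  have d: "(\<phi> has_real_derivative d s) (at s)" if "0 < s" for s
  proof -
    have "\<phi> differentiable_on {0<..}"
      using \<phi>(2) by (rule differentiable_on_subset) auto
    then have "\<phi> differentiable at s"
      using that by (simp add: differentiable_on_eq_differentiable_at)
    then show ?thesis
      unfolding d_def by (simp add: DERIV_deriv_iff_real_differentiable)
  qed
  have tangent: "d s * (t - s) \<le> \<phi> t - \<phi> s" if "0 < s" "0 \<le> t" for s t
    using convex_on_imp_above_tangent[OF \<phi>(4), of s t] d[OF that(1)] that
    by (auto simp: has_field_derivative_at_within interior_real_atLeast)
  \<comment> \<open>The tangent at \<open>s\<close>, read at 0 where \<open>\<phi>\<close> vanishes,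
    gives \<open>d s * s \<ge> \<phi> s > 0\<close>.\<close>
  have d_nonneg: "0 \<le> d s" if "0 < s" for s
  proof -
    have "0 < \<phi> s" using \<phi>(1,3) that by (auto dest!: strict_mono_onD[of _ _ 0 s])
    moreover have "\<phi> s \<le> d s * s" using tangent[of s 0] \<phi>(1) that by simp
    ultimately show ?thesis using that by (smt (verit) mult_neg_pos)
  qed
  have \<phi>_nonneg: "0 \<le> \<phi> s" if "0 < s" for s
    using \<phi>(1,3) that by (auto dest!: strict_mono_onD[of _ _ 0 s])
  have d_mono: "d s \<le> d t" if "0 < s" "s \<le> t" for s t
  proof -
    have "d s * (t - s) \<le> d t * (t - s)"
      using tangent[of s t] tangent[of t s] that by (auto simp: algebra_simps)
    then show ?thesis using that by (cases "s = t") auto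
  qed
  obtain r where r: "\<And>s. 0 < s \<Longrightarrow> 0 \<le> \<rho> s \<and> (\<rho> has_real_derivative r s) (at s)"
    and r_mono: "strict_mono_on {0<..} r" and r_unbounded: "\<And>K. \<exists>s>0. K < r s"
    using \<rho> unfolding superlinear_convex_def by metis
  have pos: "0 < \<sigma>2 / \<xi>" using assms by simp
  let ?D = "\<lambda>s. \<kappa> * (d (B * s) * B) + \<sigma>2 / \<xi> * r s"
  show ?thesis
    unfolding superlinear_convex_def
  proof (intro exI[of _ ?D] conjI allI impI)
    fix s :: real
    assume s: "0 < s"
    then have Bs: "0 < B * s" using assms by simp
    show "0 \<le> total_power \<kappa> \<phi> B \<sigma>2 \<xi> \<rho> 0 s"
      using r[OF s] \<phi>_nonneg[OF Bs] pos assms by (simp add: total_power_def)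
    have "((\<lambda>s. \<phi> (B * s)) has_real_derivative d (B * s) * B) (at s)"
      using d[OF Bs] by (rule DERIV_chain2) (auto intro!: derivative_eq_intros)
    then have "(total_power \<kappa> \<phi> B \<sigma>2 \<xi> \<rho> 0 has_real_derivative ?D s + 0) (at s)"
      unfolding total_power_def[abs_def] using r[OF s]
      by (intro DERIV_add DERIV_cmult DERIV_const) auto
    then show "(total_power \<kappa> \<phi> B \<sigma>2 \<xi> \<rho> 0 has_real_derivative ?D s) (at s)"
      by simp
  next
    show "strict_mono_on {0<..} ?D"
    proof (rule strict_mono_onI)
      fix s t :: real
      assume st: "s \<in> {0<..}" "t \<in> {0<..}" "s < t"
      then have "d (B * s) \<le> d (B * t)" using assms by (intro d_mono) auto
      then have "\<kappa> * (d (B * s) * B) \<le> \<kappa> * (d (B * t) * B)"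
        using assms by (intro mult_left_mono mult_right_mono) auto
      moreover have "\<sigma>2 / \<xi> * r s < \<sigma>2 / \<xi> * r t"
        using pos strict_mono_onD[OF r_mono st] by (rule mult_strict_left_mono[rotated])
      ultimately show "?D s < ?D t" by linarith
    qed
  next
    fix K
    obtain s where s: "0 < s" "K / (\<sigma>2 / \<xi>) < r s" using r_unbounded by blast
    then have "K < \<sigma>2 / \<xi> * r s" by (subst (asm) pos_divide_less_eq[OF pos]) (simp add: mult.commute)
    moreover have "0 \<le> \<kappa> * (d (B * s) * B)" using assms s d_nonneg[of "B * s"] by simp
    ultimately show "\<exists>s>0. K < ?D s" using s(1) by (intro exI[of _ s]) linarith
  qed
qed

section \<open>Minimization of the energy per bit\<close>

text \<open>The quotient has derivative \<open>F s / (B * s\<^sup>2)\<close>, so only the sign of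
  \<open>F\<close> matters. Its zero is obtained from a minimum over a compact interval rather than
  by the intermediate value theorem, since \<open>superlinear_convex\<close> does not state that the
  derivative is continuous. Each \<open>deriv\<close> is paired with differentiability because
  \<open>deriv\<close> is total and carries no information where no derivative exists.\<close>

lemma energy_per_bit_minimization:
  fixes f :: "real \<Rightarrow> real"
  assumes "0 < B" "0 < c" and f: "superlinear_convex f" and P: "P = (\<lambda>s. f s + c)"
    and E: "E = energy_per_bit B P"
  shows "(\<exists>!s. is_arg_min E (\<lambda>s. 0 \<le> s) s) \<and>
    (\<forall>sopt. is_arg_min E (\<lambda>s. 0 \<le> s) sopt \<longrightarrow>
      P differentiable at sopt \<and> deriv P sopt = P sopt / sopt \<and>
      strict_antimono_on {0<..sopt} E \<and>
      (\<forall>s\<in>{0<..<sopt}. P differentiable at s \<and> deriv P s < P s / s) \<and>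
      strict_mono_on {sopt..} E \<and>
      (\<forall>s\<in>{sopt<..}. P differentiable at s \<and> deriv P s > P s / s))"
proof -
  obtain D where D: "\<And>s. 0 < s \<Longrightarrow> (P has_real_derivative D s) (at s)"
    and P_ge: "\<And>s. 0 < s \<Longrightarrow> c \<le> P s"
    and D_mono: "strict_mono_on {0<..} D" and D_unbounded: "\<And>K. \<exists>s>0. K < D s"
  proof -
    obtain D where "\<And>s. 0 < s \<Longrightarrow> 0 \<le> f s \<and> (f has_real_derivative D s) (at s)"
      "strict_mono_on {0<..} D" "\<And>K. \<exists>s>0. K < D s"
      using f unfolding superlinear_convex_def by metis
    then show ?thesis
      using P by (intro that[of D]) (auto intro!: derivative_eq_intros)
  qed
  define F where "F s = s * D s - P s" for s
  \<comment> \<open>The mean value theorem bounds \<open>P t - P s\<close> by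
    \<open>(t - s) * D t\<close>; the products with \<open>t\<close> then cancel. The quantitative
    gain is what later makes \<open>F\<close> nonnegative far out.\<close>
  have F_incr: "s * (D t - D s) < F t - F s" if st: "0 < s" "s < t" for s t
  proof -
    obtain z where z: "s < z" "z < t" "P t - P s = (t - s) * D z"
      using MVT2[of s t P D] D st by force
    have "D z < D t" using strict_mono_onD[OF D_mono, of z t] z st by auto
    then have "(t - s) * D z < (t - s) * D t" using st by simp
    then show ?thesis using z unfolding F_def by (simp add: algebra_simps)
  qed
  have F_less: "F s < F t" if st: "0 < s" "s < t" for s t
  proof -
    have "0 < s * (D t - D s)" using strict_mono_onD[OF D_mono, of s t] st by simp
    then show ?thesis using F_incr[OF st] by linarith
  qed
  define e where "e s = P s / (B * s)" for s
  have E_e: "E s = ereal (e s)" if "0 < s" for s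
    using that by (simp add: E energy_per_bit_def e_def)
  have e_deriv: "(e has_real_derivative F s / (B * s\<^sup>2)) (at s)" if "0 < s" for s
    unfolding e_def[abs_def] using that \<open>0 < B\<close> D[OF that]
    by (auto intro!: derivative_eq_intros simp: F_def divide_simps power2_eq_square algebra_simps)
  have e_cont: "continuous_on {a..b} e" if "0 < a" for a b
    by (rule DERIV_continuous_on[OF has_field_derivative_at_within[OF e_deriv]]) (use that in auto)
  \<comment> \<open>As \<open>F\<close> is strictly increasing, its sign at the right end point
    decides the whole open interval; the end point itself may be the zero of
    \<open>F\<close>.\<close>
  have e_decr: "e t < e s" if "0 < s" "s < t" "F t \<le> 0" for s t
  proof (rule DERIV_neg_imp_decreasing_open[OF \<open>s < t\<close> _ e_cont[OF \<open>0 < s\<close>]])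
    fix x assume x: "s < x" "x < t"
    then have "F x < 0" using F_less[of x t] that by simp
    then show "\<exists>y. (e has_real_derivative y) (at x) \<and> y < 0"
      using e_deriv[of x] x that \<open>0 < B\<close>
      by (intro exI[of _ "F x / (B * x\<^sup>2)"]) (auto intro!: divide_neg_pos)
  qed
  have e_incr: "e s < e t" if "0 < s" "s < t" "0 \<le> F s" for s t
  proof (rule DERIV_pos_imp_increasing_open[OF \<open>s < t\<close> _ e_cont[OF \<open>0 < s\<close>]])
    fix x assume x: "s < x" "x < t"
    then have "0 < F x" using F_less[of s x] that by simp
    then show "\<exists>y. (e has_real_derivative y) (at x) \<and> y > 0"
      using e_deriv[of x] x that \<open>0 < B\<close>
      by (intro exI[of _ "F x / (B * x\<^sup>2)"]) (auto intro!: divide_pos_pos)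
  qed
  \<comment> \<open>\<open>F_incr\<close> from 1 gives \<open>F b > F 1 + D b - D 1\<close>, so
    \<open>D u > D 1 - F 1\<close> is enough; the maximum with 2 puts \<open>b\<close> beyond
    1.\<close>
  obtain b where b: "1 < b" "0 \<le> F b"
  proof -
    obtain u where u: "0 < u" "D 1 - F 1 < D u" using D_unbounded by blast
    define b where "b = max 2 u"
    have "D u \<le> D b"
      using strict_mono_on_leD[OF D_mono, of u b] u(1) by (simp add: b_def)
    moreover have "1 < b" by (simp add: b_def)
    ultimately show ?thesis using F_incr[of 1 b] u by (intro that[of b]) auto
  qed
  \<comment> \<open>For \<open>s\<close> up to \<open>a\<close>, the constant power alone costs
    \<open>c / (B * s) \<ge> e 1\<close>, so no point there beats 1, which lies in the compact
    interval.\<close>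
  define a where "a = min 1 (c / (B * e 1))"
  have e1: "0 < e 1" using P_ge[of 1] assms by (simp add: e_def)
  have a: "0 < a" "a \<le> 1" using assms e1 by (auto simp: a_def)
  have e_small: "e 1 \<le> e s" if "0 < s" "s \<le> a" for s
  proof -
    have "s * (B * e 1) \<le> c" using that e1 assms by (auto simp: a_def pos_le_divide_eq)
    then have "e 1 * (B * s) \<le> P s" using P_ge[of s] that by (simp add: mult_ac)
    then show ?thesis using that assms by (simp add: e_def pos_le_divide_eq)
  qed
  obtain s0 where s0: "s0 \<in> {a..b}" "\<And>s. s \<in> {a..b} \<Longrightarrow> e s0 \<le> e s"
    using continuous_attains_inf[of "{a..b}" e] e_cont[OF a(1)] a b by auto
  have s0_pos: "0 < s0" using s0 a by auto
  have s0_min: "e s0 \<le> e s" if "0 < s" for s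
  proof -
    consider "s \<le> a" | "s \<in> {a..b}" | "b < s" by force
    then show ?thesis
    proof cases
      case 1
      then show ?thesis using e_small[OF that] s0(2)[of 1] a b by force
    next
      case 3
      then show ?thesis using e_incr[of b s] s0(2)[of b] a b by force
    qed (rule s0(2))
  qed
  \<comment> \<open>A minimum over all positive reals is a local one: the neighbourhood of radius
    \<open>s0\<close> stays positive.\<close>
  have "F s0 / (B * s0\<^sup>2) = 0"
    using s0_pos s0_min
    by (intro DERIV_local_min[OF e_deriv[OF s0_pos] s0_pos]) auto
  then have F0: "F s0 = 0" using s0_pos \<open>0 < B\<close> by simp
  have e_min: "e s0 < e s" if "0 < s" "s \<noteq> s0" for s
    using e_decr[of s s0] e_incr[of s0 s] F0 that s0_pos by force
  have E0: "E 0 = \<infinity>" by (simp add: E energy_per_bit_def)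
  have argmin: "is_arg_min E (\<lambda>s. 0 \<le> s) s \<longleftrightarrow> s = s0" for s
  proof
    assume *: "is_arg_min E (\<lambda>s. 0 \<le> s) s"
    then have s: "0 \<le> s" "\<not> E s0 < E s" using s0_pos by (auto simp: is_arg_min_def)
    then have "s \<noteq> 0" using E0 E_e[OF s0_pos] by auto
    then show "s = s0" using s E_e[of s] E_e[OF s0_pos] e_min[of s] by force
  next
    assume "s = s0"
    moreover have "\<not> E y < E s0" if "0 \<le> y" for y
      using that E0 E_e[of y] E_e[OF s0_pos] s0_min[of y] by (cases "y = 0") auto
    ultimately show "is_arg_min E (\<lambda>s. 0 \<le> s) s"
      using s0_pos by (auto simp: is_arg_min_def)
  qed
  have diff: "P differentiable at s" and deriv: "deriv P s = D s" if "0 < s" for s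
    using D[OF that] by (auto simp: real_differentiable_def DERIV_imp_deriv)
  have slope: "D s - P s / s = F s / s" if "0 < s" for s
    using that by (simp add: F_def field_simps)
  show ?thesis
  proof (intro conjI allI impI ballI)
    show "\<exists>!s. is_arg_min E (\<lambda>s. 0 \<le> s) s" by (simp add: argmin)
  next
    fix sopt assume "is_arg_min E (\<lambda>s. 0 \<le> s) sopt"
    then have so: "sopt = s0" by (simp add: argmin)
    show "P differentiable at sopt" using diff s0_pos so by simp
    show "deriv P sopt = P sopt / sopt" using deriv slope[OF s0_pos] F0 s0_pos so by simp
    show "strict_antimono_on {0<..sopt} E"
    proof (rule monotone_onI)
      fix s t assume *: "s \<in> {0<..sopt}" "t \<in> {0<..sopt}" "s < t"
      then have "F t \<le> 0" using F_less[of t s0] F0 so by (cases "t = s0") auto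
      then show "E t < E s" using * e_decr[of s t] by (simp add: E_e)
    qed
    show "strict_mono_on {sopt..} E"
    proof (rule monotone_onI)
      fix s t assume *: "s \<in> {sopt..}" "t \<in> {sopt..}" "s < t"
      then have "0 \<le> F s" using F_less[of s0 s] F0 s0_pos so by (cases "s = s0") auto
      then show "E s < E t" using * e_incr[of s t] s0_pos so by (simp add: E_e)
    qed
    fix s
    {
      assume *: "s \<in> {0<..<sopt}"
      then show "P differentiable at s" using diff by simp
      have "F s / s < 0" using * F_less[of s s0] F0 so by (auto intro!: divide_neg_pos)
      then show "deriv P s < P s / s" using * deriv slope[of s] by simp
    }
    {
      assume *: "s \<in> {sopt<..}"
      then show "P differentiable at s" using diff s0_pos so by simp
      have "0 < F s / s" using * F_less[of s0 s] F0 so s0_pos by auto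
      then show "deriv P s > P s / s" using * deriv slope[of s] s0_pos so by simp
    }
  qed
qed

section \<open>Expected rates over a random channel gain\<close>

text \<open>A nonnegative difference with zero integral vanishes almost everywhere. The strict
  monotonicity of \<open>rate\<close> and \<open>marginal\<close> rests on this.\<close>

lemma (in prob_space) integral_less_not_AE_eq:
  fixes X Y :: "'a \<Rightarrow> real"
  assumes "integrable M X" "integrable M Y"
    and le: "\<And>\<omega>. \<omega> \<in> space M \<Longrightarrow> X \<omega> \<le> Y \<omega>"
    and "\<not> (AE \<omega> in M. Y \<omega> = X \<omega>)"
  shows "expectation X < expectation Y"
proof -
  have "expectation (\<lambda>\<omega>. Y \<omega> - X \<omega>) \<noteq> 0"
    using assms(4) by (subst integral_nonneg_eq_0_iff_AE) (auto simp: assms(1,2) le)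
  moreover have "expectation X \<le> expectation Y"
    using assms(1,2) le by (rule integral_mono)
  ultimately show ?thesis using assms(1,2) by simp
qed

text \<open>The density is represented by its consequence \<open>G_nonzero\<close>, so that a
  positive constant gain is an instance too and the static channel falls under the same
  argument.\<close>

locale fading = prob_space M for M :: "'a measure" +
  fixes G :: "'a \<Rightarrow> real"
  assumes G_measurable [measurable]: "G \<in> borel_measurable M"
    and G_nonneg: "\<And>\<omega>. \<omega> \<in> space M \<Longrightarrow> 0 \<le> G \<omega>"
    and G_nonzero: "\<not> (AE \<omega> in M. G \<omega> = 0)"
    and capacity_integrable: "\<And>p. 0 \<le> p \<Longrightarrow> integrable M (\<lambda>\<omega>. log 2 (1 + G \<omega> * p))"

text \<open>
  Both \<open>\<psi> x = log 2 (1 + x)\<close> (constant power) and \<open>\<psi> x = log 2 (max 1 x)\<close> (water filling at a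
  given water level) qualify.
\<close>

locale fading_rate = fading M G for M :: "'a measure" and G +
  fixes \<psi> :: "real \<Rightarrow> real"
  assumes \<psi>_measurable [measurable]: "\<psi> \<in> borel_measurable borel"
    and \<psi>_nonneg: "\<And>x. 0 \<le> x \<Longrightarrow> 0 \<le> \<psi> x"
    and \<psi>_le: "\<And>x. 0 \<le> x \<Longrightarrow> \<psi> x \<le> log 2 (1 + x)"
    and \<psi>_ge: "\<And>x. 0 < x \<Longrightarrow> log 2 x \<le> \<psi> x"
    and \<psi>_diff: "\<And>x y. 0 < x \<Longrightarrow> 0 < y \<Longrightarrow> \<bar>\<psi> x - \<psi> y\<bar> \<le> \<bar>log 2 x - log 2 y\<bar>"
    and \<psi>_less: "\<And>x y. 0 \<le> x \<Longrightarrow> x < y \<Longrightarrow> 0 < \<psi> x \<Longrightarrow> \<psi> x < \<psi> y"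
begin

definition rate :: "real \<Rightarrow> real" where
  "rate u = expectation (\<lambda>\<omega>. \<psi> (G \<omega> * u))"

lemma \<psi>_mono: "0 \<le> x \<Longrightarrow> x \<le> y \<Longrightarrow> \<psi> x \<le> \<psi> y"
  using \<psi>_less[of x y] \<psi>_nonneg[of x] \<psi>_nonneg[of y] by (cases "\<psi> x = 0"; cases "x = y") auto

lemma \<psi>_0: "\<psi> 0 = 0"
  using \<psi>_nonneg[of 0] \<psi>_le[of 0] by simp

lemma \<psi>_integrable:
  assumes "0 \<le> u"
  shows "integrable M (\<lambda>\<omega>. \<psi> (G \<omega> * u))"
proof (rule Bochner_Integration.integrable_bound[OF capacity_integrable[OF assms]])
  show "AE \<omega> in M. norm (\<psi> (G \<omega> * u)) \<le> norm (log 2 (1 + G \<omega> * u))"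
  proof (rule AE_I2)
    fix \<omega> assume "\<omega> \<in> space M"
    then have "0 \<le> G \<omega> * u" using G_nonneg assms by simp
    then show "norm (\<psi> (G \<omega> * u)) \<le> norm (log 2 (1 + G \<omega> * u))"
      using \<psi>_nonneg[of "G \<omega> * u"] \<psi>_le[of "G \<omega> * u"] by simp
  qed
qed measurable

text \<open>On a logarithmic scale the gain cancels:
  \<open>log 2 (G \<omega> * u) - log 2 (G \<omega> * v)\<close> is the same in every state of
  positive gain. So \<open>rate\<close> is 1-Lipschitz in \<open>log 2 u\<close>, which yields its
  continuity.\<close>

lemma rate_diff:
  assumes "0 < u" "0 < v"
  shows "\<bar>rate u - rate v\<bar> \<le> \<bar>log 2 u - log 2 v\<bar>"
proof -
  have "\<bar>\<psi> (G \<omega> * u) - \<psi> (G \<omega> * v)\<bar> \<le> \<bar>log 2 u - log 2 v\<bar>" if "\<omega> \<in> space M" for \<omega>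
  proof (cases "G \<omega> = 0")
    case False
    then have "0 < G \<omega>" using G_nonneg[OF that] by simp
    then show ?thesis
      using \<psi>_diff[of "G \<omega> * u" "G \<omega> * v"] assms by (simp add: log_mult)
  qed simp
  then have "expectation (\<lambda>\<omega>. \<bar>\<psi> (G \<omega> * u) - \<psi> (G \<omega> * v)\<bar>) \<le> expectation (\<lambda>\<omega>. \<bar>log 2 u - log 2 v\<bar>)"
    using assms
    by (intro integral_mono integrable_abs Bochner_Integration.integrable_diff \<psi>_integrable) auto
  moreover have "\<bar>rate u - rate v\<bar> \<le> expectation (\<lambda>\<omega>. \<bar>\<psi> (G \<omega> * u) - \<psi> (G \<omega> * v)\<bar>)"
    unfolding rate_def using assms
    by (subst Bochner_Integration.integral_diff[symmetric]) (auto intro!: \<psi>_integrable integral_abs_bound)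
  ultimately show ?thesis by (simp add: prob_space)
qed

lemma continuous_on_rate: "continuous_on {0<..} rate"
proof -
  have "(rate \<longlongrightarrow> rate u) (at u within {0<..})" if u: "0 < u" for u
  proof -
    have "((\<lambda>v. log 2 v - log 2 u) \<longlongrightarrow> log 2 u - log 2 u) (at u within {0<..})"
      using u by (intro tendsto_intros) auto
    then have lim: "((\<lambda>v. \<bar>log 2 v - log 2 u\<bar>) \<longlongrightarrow> 0) (at u within {0<..})"
      by (simp add: tendsto_rabs_zero)
    have "((\<lambda>v. rate v - rate u) \<longlongrightarrow> 0) (at u within {0<..})"
      by (rule tendsto_rabs_zero_cancel, rule tendsto_sandwich[OF _ _ tendsto_const lim])
        (use u in \<open>auto simp: eventually_at_filter rate_diff\<close>)
    then show ?thesis by (simp add: LIM_zero_iff)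
  qed
  then show ?thesis by (simp add: continuous_on_def)
qed

text \<open>Equality almost everywhere would force \<open>\<psi> (G \<omega> * u) = 0\<close> almost
  everywhere, because \<open>\<psi>\<close> strictly increases from any point where it is positive;
  then \<open>rate u\<close> would be 0.\<close>

lemma rate_less:
  assumes "0 \<le> u" "u < v" "0 < rate u"
  shows "rate u < rate v"
  unfolding rate_def
proof (rule integral_less_not_AE_eq)
  show "\<psi> (G \<omega> * u) \<le> \<psi> (G \<omega> * v)" if "\<omega> \<in> space M" for \<omega>
    using G_nonneg[OF that] assms by (intro \<psi>_mono mult_left_mono) auto
  show "\<not> (AE \<omega> in M. \<psi> (G \<omega> * v) = \<psi> (G \<omega> * u))"
  proof
    assume "AE \<omega> in M. \<psi> (G \<omega> * v) = \<psi> (G \<omega> * u)"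
    then have "AE \<omega> in M. \<psi> (G \<omega> * u) = 0"
    proof (rule AE_mp, intro AE_I2 impI)
      fix \<omega> assume \<omega>: "\<omega> \<in> space M" "\<psi> (G \<omega> * v) = \<psi> (G \<omega> * u)"
      show "\<psi> (G \<omega> * u) = 0"
      proof (cases "G \<omega> = 0")
        case False
        then have "G \<omega> * u < G \<omega> * v" "0 \<le> G \<omega> * u"
          using G_nonneg[OF \<omega>(1)] assms by auto
        then show ?thesis using \<psi>_less[of "G \<omega> * u" "G \<omega> * v"] \<psi>_nonneg[of "G \<omega> * u"] \<omega>(2) by force
      qed (simp add: \<psi>_0)
    qed
    then have "rate u = 0" unfolding rate_def by (rule integral_eq_zero_AE)
    then show False using assms by simp
  qed
qed (use assms in \<open>auto intro!: \<psi>_integrable\<close>)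

text \<open>Dominated convergence along \<open>1 / real (Suc n)\<close>, the integrable bound being
  the capacity integrand at power 1.\<close>

lemma rate_small:
  assumes "0 < e"
  shows "\<exists>u>0. rate u < e"
proof -
  have "(\<lambda>n. rate (1 / real (Suc n))) \<longlonglongrightarrow> expectation (\<lambda>_. 0)"
    unfolding rate_def
  proof (rule integral_dominated_convergence[where w = "\<lambda>\<omega>. log 2 (1 + G \<omega> * 1)"])
    show "AE \<omega> in M. (\<lambda>n. \<psi> (G \<omega> * (1 / real (Suc n)))) \<longlonglongrightarrow> 0"
    proof (intro AE_I2)
      fix \<omega> assume \<omega>: "\<omega> \<in> space M"
      have "(\<lambda>n. log 2 (1 + G \<omega> * (1 / real (Suc n)))) \<longlonglongrightarrow> log 2 (1 + G \<omega> * 0)"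
        by (intro tendsto_intros LIMSEQ_Suc[OF lim_1_over_n]) auto
      then have lim: "(\<lambda>n. log 2 (1 + G \<omega> * (1 / real (Suc n)))) \<longlonglongrightarrow> 0" by simp
      have "0 \<le> G \<omega> * (1 / real (Suc n))" for n using G_nonneg[OF \<omega>] by simp
      then show "(\<lambda>n. \<psi> (G \<omega> * (1 / real (Suc n)))) \<longlonglongrightarrow> 0"
        using \<psi>_nonneg \<psi>_le by (intro tendsto_sandwich[OF _ _ tendsto_const lim] always_eventually) auto
    qed
    show "AE \<omega> in M. norm (\<psi> (G \<omega> * (1 / real (Suc n)))) \<le> log 2 (1 + G \<omega> * 1)" for n
    proof (intro AE_I2)
      fix \<omega> assume \<omega>: "\<omega> \<in> space M"
      have "0 \<le> G \<omega> * (1 / real (Suc n))" "G \<omega> * (1 / real (Suc n)) \<le> G \<omega> * 1"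
        using G_nonneg[OF \<omega>] by (simp, intro mult_left_mono) auto
      then show "norm (\<psi> (G \<omega> * (1 / real (Suc n)))) \<le> log 2 (1 + G \<omega> * 1)"
        using \<psi>_nonneg[of "G \<omega> * (1 / real (Suc n))"] \<psi>_mono[of "G \<omega> * (1 / real (Suc n))" "G \<omega> * 1"]
          \<psi>_le[of "G \<omega> * 1"] unfolding real_norm_def by linarith
    qed
  qed (use capacity_integrable[of 1] in auto)
  then have "\<forall>\<^sub>F n in sequentially. rate (1 / real (Suc n)) < e"
    using assms by (intro order_tendstoD) auto
  then obtain n where "rate (1 / real (Suc n)) < e"
    by (auto simp: eventually_sequentially)
  then show ?thesis by (intro exI[of _ "1 / real (Suc n)"]) auto
qed

text \<open>A gain that is not almost surely 0 exceeds some \<open>d > 0\<close> with positive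
  probability, and on that event the rate is at least \<open>log 2 (d * u)\<close>.\<close>

lemma rate_large: "\<exists>u>b. K < rate u"
proof -
  have "\<exists>n. \<not> (AE \<omega> in M. G \<omega> < 1 / real (Suc n))"
  proof (rule ccontr)
    assume "\<not> ?thesis"
    then have "AE \<omega> in M. \<forall>n. G \<omega> < 1 / real (Suc n)" by (simp add: AE_all_countable)
    then have "AE \<omega> in M. G \<omega> = 0"
    proof (rule AE_mp, intro AE_I2 impI)
      fix \<omega> assume \<omega>: "\<omega> \<in> space M" "\<forall>n. G \<omega> < 1 / real (Suc n)"
      then have "\<not> 0 < G \<omega>" using reals_Archimedean[of "G \<omega>"] by (auto simp: inverse_eq_divide dest: less_asym)
      then show "G \<omega> = 0" using G_nonneg[OF \<omega>(1)] by simp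
    qed
    then show False using G_nonzero by simp
  qed
  then obtain n where n: "\<not> (AE \<omega> in M. G \<omega> < 1 / real (Suc n))" ..
  define d where "d = 1 / real (Suc n)"
  have d: "0 < d" by (simp add: d_def)
  define A where "A = {\<omega> \<in> space M. d \<le> G \<omega>}"
  have A [measurable]: "A \<in> sets M" unfolding A_def by measurable
  have "prob A \<noteq> 0"
  proof
    assume "prob A = 0"
    then have "AE \<omega> in M. \<omega> \<notin> A" using A by (simp add: prob_eq_0)
    then have "AE \<omega> in M. G \<omega> < d" by (rule AE_mp) (auto intro!: AE_I2 simp: A_def)
    then show False using n by (simp add: d_def)
  qed
  then have q: "0 < prob A" by (simp add: zero_less_measure_iff)
  \<comment> \<open>The first entry makes \<open>L * prob A\<close> exceed \<open>K\<close>; the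
    second makes \<open>u = 2 powr L / d\<close> exceed \<open>b\<close>.\<close>
  define L where "L = max ((\<bar>K\<bar> + 1) / prob A) (log 2 (d * (\<bar>b\<bar> + 1)))"
  define u where "u = 2 powr L / d"
  have u: "0 < u" using d by (simp add: u_def)
  have log: "log 2 (d * u) = L" using d by (simp add: u_def)
  have "d * (\<bar>b\<bar> + 1) \<le> 2 powr L"
    using d by (subst log_le_iff[symmetric]) (auto simp: L_def)
  then have "\<bar>b\<bar> + 1 \<le> u" using d by (simp add: u_def pos_le_divide_eq mult.commute)
  then have "b < u" by linarith
  have "L * indicator A \<omega> \<le> \<psi> (G \<omega> * u)" if "\<omega> \<in> space M" for \<omega>
  proof (cases "\<omega> \<in> A")
    case True
    then have "d * u \<le> G \<omega> * u" using u by (auto simp: A_def)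
    moreover have "0 < d * u" using d u by simp
    ultimately have "L \<le> \<psi> (G \<omega> * u)"
      using \<psi>_ge[of "d * u"] \<psi>_mono[of "d * u" "G \<omega> * u"] log by linarith
    then show ?thesis using True by simp
  next
    case False
    then show ?thesis using \<psi>_nonneg[of "G \<omega> * u"] G_nonneg[OF that] u by simp
  qed
  then have "expectation (\<lambda>\<omega>. L * indicator A \<omega>) \<le> rate u"
    unfolding rate_def using u
    by (intro integral_mono \<psi>_integrable integrable_mult_right) (auto simp: emeasure_eq_measure)
  then have "L * prob A \<le> rate u" by simp
  moreover have "\<bar>K\<bar> + 1 \<le> L * prob A" using q unfolding pos_divide_le_eq[OF q, symmetric] by (simp add: L_def)
  ultimately show ?thesis using \<open>b < u\<close> by (intro exI[of _ u]) auto
qed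

lemma rate_surj:
  assumes "0 < s"
  shows "\<exists>u>0. rate u = s"
proof -
  obtain a where a: "0 < a" "rate a < s" using rate_small[OF assms] by blast
  obtain b where b: "a < b" "s < rate b" using rate_large by blast
  have "\<exists>u\<ge>a. u \<le> b \<and> rate u = s"
    using a b by (intro IVT' continuous_on_subset[OF continuous_on_rate]) auto
  then obtain u where "a \<le> u" "rate u = s" by blast
  then show ?thesis using a by (intro exI[of _ u]) simp
qed

end

section \<open>Constant power: the transmitter knows the distribution of the gain\<close>

context fading
begin

sublocale capacity: fading_rate M G "\<lambda>x. log 2 (1 + x)"
proof
  fix x y :: real
  assume xy: "0 < x" "0 < y"
  \<comment> \<open>Adding 1 to numerator and denominator shrinks a ratio that is at least 1;
    symmetry covers the other order.\<close>
  have le: "\<bar>ln (1 + x) - ln (1 + y)\<bar> \<le> \<bar>ln x - ln y\<bar>" if "0 < x" "x \<le> y" for x y :: real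
  proof -
    have "(1 + y) / (1 + x) \<le> y / x" using that by (simp add: divide_simps algebra_simps)
    then have "ln ((1 + y) / (1 + x)) \<le> ln (y / x)" using that by (subst ln_le_cancel_iff) auto
    then show ?thesis using that by (simp add: ln_div)
  qed
  have "\<bar>ln (1 + x) - ln (1 + y)\<bar> \<le> \<bar>ln x - ln y\<bar>"
    using le[of x y] le[of y x] xy by (cases "x \<le> y") (auto simp: abs_minus_commute)
  then show "\<bar>log 2 (1 + x) - log 2 (1 + y)\<bar> \<le> \<bar>log 2 x - log 2 y\<bar>"
    by (simp add: log_def divide_right_mono flip: diff_divide_distrib)
qed auto

text \<open>Up to the factor \<open>1 / ln 2\<close>, the expected pointwise derivative of the
  capacity in \<open>p\<close>. It is used only as the slope in
  \<open>capacity_tangent\<close>.\<close>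

definition marginal :: "real \<Rightarrow> real" where
  "marginal p = expectation (\<lambda>\<omega>. G \<omega> / (1 + G \<omega> * p))"

lemma marginal_le_inverse:
  fixes g p :: real
  assumes "0 < p" "0 \<le> g"
  shows "g / (1 + g * p) \<le> 1 / p"
proof -
  have "0 < 1 + g * p" using assms by (simp add: add_pos_nonneg)
  then show ?thesis using assms by (simp add: field_simps)
qed

lemma marginal_integrable:
  assumes "0 < p"
  shows "integrable M (\<lambda>\<omega>. G \<omega> / (1 + G \<omega> * p))"
proof (rule integrable_const_bound[where B = "1 / p"])
  show "AE \<omega> in M. norm (G \<omega> / (1 + G \<omega> * p)) \<le> 1 / p"
    using assms G_nonneg marginal_le_inverse[OF assms] by (auto intro!: AE_I2)
qed measurable

lemma marginal_le: "0 < p \<Longrightarrow> marginal p \<le> 1 / p"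
  unfolding marginal_def
  by (rule integral_le_const[OF marginal_integrable])
    (auto intro!: AE_I2 marginal_le_inverse G_nonneg)

lemma marginal_pos:
  assumes "0 < p"
  shows "0 < marginal p"
proof -
  have "expectation (\<lambda>_. 0) < marginal p"
    unfolding marginal_def
  proof (rule integral_less_not_AE_eq[OF _ marginal_integrable[OF assms]])
    show "\<not> (AE \<omega> in M. G \<omega> / (1 + G \<omega> * p) = 0)"
    proof
      assume "AE \<omega> in M. G \<omega> / (1 + G \<omega> * p) = 0"
      then have "AE \<omega> in M. G \<omega> = 0"
      proof (rule AE_mp, intro AE_I2 impI)
        fix \<omega> assume \<omega>: "\<omega> \<in> space M" "G \<omega> / (1 + G \<omega> * p) = 0"
        have "0 < 1 + G \<omega> * p" using G_nonneg[OF \<omega>(1)] assms by (simp add: add_pos_nonneg)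
        then show "G \<omega> = 0" using \<omega>(2) by auto
      qed
      then show False using G_nonzero by simp
    qed
  qed (use G_nonneg assms in auto)
  then show ?thesis by simp
qed

lemma marginal_less:
  assumes "0 < p" "p < q"
  shows "marginal q < marginal p"
  unfolding marginal_def
proof (rule integral_less_not_AE_eq)
  \<comment> \<open>In this form the difference is visibly nonnegative and zero only at
    \<open>g = 0\<close>.\<close>
  have diff: "g / (1 + g * p) - g / (1 + g * q) = g\<^sup>2 * (q - p) / ((1 + g * p) * (1 + g * q))"
    if "0 \<le> g" for g
  proof -
    have "0 < 1 + g * p" "0 < 1 + g * q" using that assms by (auto simp: add_pos_nonneg)
    then show ?thesis by (simp add: divide_simps power2_eq_square algebra_simps)
  qed
  show "G \<omega> / (1 + G \<omega> * q) \<le> G \<omega> / (1 + G \<omega> * p)" if "\<omega> \<in> space M" for \<omega>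
  proof -
    have "0 \<le> (G \<omega>)\<^sup>2 * (q - p) / ((1 + G \<omega> * p) * (1 + G \<omega> * q))"
      using assms G_nonneg[OF that] by simp
    then show ?thesis using diff[OF G_nonneg[OF that]] by linarith
  qed
  show "\<not> (AE \<omega> in M. G \<omega> / (1 + G \<omega> * p) = G \<omega> / (1 + G \<omega> * q))"
  proof
    assume "AE \<omega> in M. G \<omega> / (1 + G \<omega> * p) = G \<omega> / (1 + G \<omega> * q)"
    then have "AE \<omega> in M. G \<omega> = 0"
    proof (rule AE_mp, intro AE_I2 impI)
      fix \<omega> assume \<omega>: "\<omega> \<in> space M" "G \<omega> / (1 + G \<omega> * p) = G \<omega> / (1 + G \<omega> * q)"
      have "0 < 1 + G \<omega> * p" "0 < 1 + G \<omega> * q"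
        using G_nonneg[OF \<omega>(1)] assms by (auto simp: add_pos_nonneg)
      then show "G \<omega> = 0" using diff[OF G_nonneg[OF \<omega>(1)]] \<omega>(2) assms by auto
    qed
    then show False using G_nonzero by simp
  qed
qed (use assms in \<open>auto intro!: marginal_integrable\<close>)

text \<open>Pointwise this is \<open>ln z \<le> z - 1\<close> for the ratio \<open>z\<close> of
  \<open>1 + G \<omega> * q\<close> to \<open>1 + G \<omega> * p\<close>; the right-hand side is
  affine in \<open>q\<close> and can be integrated directly.\<close>

lemma capacity_tangent:
  assumes "0 < p" "0 < q"
  shows "capacity.rate q \<le> capacity.rate p + marginal p / ln 2 * (q - p)"
proof -
  define c where "c = (q - p) / ln 2"
  have "log 2 (1 + G \<omega> * q) \<le> log 2 (1 + G \<omega> * p) + G \<omega> / (1 + G \<omega> * p) * c"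
    if "\<omega> \<in> space M" for \<omega>
  proof -
    let ?x = "1 + G \<omega> * p" and ?y = "1 + G \<omega> * q"
    have pos: "0 < ?x" "0 < ?y" using G_nonneg[OF that] assms by (auto simp: add_pos_nonneg)
    have "ln (?y / ?x) \<le> ?y / ?x - 1" using pos by (intro ln_le_minus_one) simp
    also have "\<dots> = G \<omega> / ?x * (q - p)" using pos by (simp add: divide_simps algebra_simps)
    finally have "ln ?y \<le> ln ?x + G \<omega> / ?x * (q - p)" using pos by (simp add: ln_div)
    then have "ln ?y / ln 2 \<le> (ln ?x + G \<omega> / ?x * (q - p)) / ln 2" by (intro divide_right_mono) auto
    then show ?thesis by (simp add: log_def c_def add_divide_distrib)
  qed
  then have "capacity.rate q \<le>
      expectation (\<lambda>\<omega>. log 2 (1 + G \<omega> * p) + G \<omega> / (1 + G \<omega> * p) * c)"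
    unfolding capacity.rate_def using assms
    by (intro integral_mono Bochner_Integration.integrable_add integrable_mult_left
        capacity_integrable marginal_integrable) auto
  also have "\<dots> = capacity.rate p + marginal p * c"
    unfolding capacity.rate_def marginal_def using assms
    by (simp add: capacity_integrable marginal_integrable
        del: times_divide_eq_left times_divide_eq_right)
  finally show ?thesis by (simp add: c_def)
qed

text \<open>The integrands at \<open>q\<close> and \<open>p\<close> differ by their product times
  \<open>p - q\<close>, and \<open>marginal_le_inverse\<close> bounds that product uniformly in the
  gain.\<close>

lemma continuous_on_marginal: "continuous_on {0<..} marginal"
proof -
  have bound: "\<bar>marginal q - marginal p\<bar> \<le> \<bar>q - p\<bar> / (q * p)" if "0 < p" "0 < q" for p q
  proof -
    have "\<bar>G \<omega> / (1 + G \<omega> * q) - G \<omega> / (1 + G \<omega> * p)\<bar> \<le> \<bar>q - p\<bar> / (q * p)"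
      if "\<omega> \<in> space M" for \<omega>
    proof -
      let ?g = "G \<omega>"
      have pos: "0 < 1 + ?g * p" "0 < 1 + ?g * q" and g: "0 \<le> ?g"
        using G_nonneg[OF that] \<open>0 < p\<close> \<open>0 < q\<close> by (auto simp: add_pos_nonneg)
      have eq: "?g / (1 + ?g * q) - ?g / (1 + ?g * p)
          = ?g / (1 + ?g * q) * (?g / (1 + ?g * p)) * (p - q)"
        using pos by (simp add: divide_simps algebra_simps)
      have "?g / (1 + ?g * q) * (?g / (1 + ?g * p)) \<le> 1 / q * (1 / p)"
        using pos g \<open>0 < p\<close> \<open>0 < q\<close> by (intro mult_mono marginal_le_inverse) auto
      then have "?g / (1 + ?g * q) * (?g / (1 + ?g * p)) * \<bar>p - q\<bar> \<le> 1 / q * (1 / p) * \<bar>p - q\<bar>"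
        by (rule mult_right_mono) auto
      then show ?thesis
        unfolding eq using pos g by (simp add: abs_mult abs_minus_commute)
    qed
    then have "expectation (\<lambda>\<omega>. \<bar>G \<omega> / (1 + G \<omega> * q) - G \<omega> / (1 + G \<omega> * p)\<bar>)
        \<le> expectation (\<lambda>_. \<bar>q - p\<bar> / (q * p))"
      using that by (intro integral_mono integrable_abs Bochner_Integration.integrable_diff
          marginal_integrable) auto
    moreover have "\<bar>marginal q - marginal p\<bar>
        \<le> expectation (\<lambda>\<omega>. \<bar>G \<omega> / (1 + G \<omega> * q) - G \<omega> / (1 + G \<omega> * p)\<bar>)"
      unfolding marginal_def using that
      by (subst Bochner_Integration.integral_diff[symmetric])
        (auto intro!: marginal_integrable integral_abs_bound)
    ultimately show ?thesis by (simp add: prob_space)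
  qed
  have "(marginal \<longlongrightarrow> marginal p) (at p within {0<..})" if p: "0 < p" for p
  proof -
    have "((\<lambda>q. \<bar>q - p\<bar> / (q * p)) \<longlongrightarrow> \<bar>p - p\<bar> / (p * p)) (at p within {0<..})"
      using p by (intro tendsto_intros) auto
    then have lim: "((\<lambda>q. \<bar>q - p\<bar> / (q * p)) \<longlongrightarrow> 0) (at p within {0<..})" by simp
    have "((\<lambda>q. marginal q - marginal p) \<longlongrightarrow> 0) (at p within {0<..})"
      by (rule tendsto_rabs_zero_cancel, rule tendsto_sandwich[OF _ _ tendsto_const lim])
        (use p in \<open>auto simp: eventually_at_filter bound\<close>)
    then show ?thesis by (simp add: LIM_zero_iff)
  qed
  then show ?thesis by (simp add: continuous_on_def)
qed

text \<open>A competitor \<open>q\<close> reaching this rate has positive rate itself, so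
  \<open>rate_less\<close> rules out \<open>q < p\<close>.\<close>

lemma rho_known_distribution_rate:
  assumes "0 < p" "0 < capacity.rate p"
  shows "rho_known_distribution M G (capacity.rate p) = p"
  unfolding rho_known_distribution_def
proof (rule Least_equality)
  show "0 \<le> p \<and> capacity.rate p \<le> expectation (\<lambda>\<omega>. log 2 (1 + G \<omega> * p))"
    using assms by (simp add: capacity.rate_def)
next
  fix q assume q: "0 \<le> q \<and> capacity.rate p \<le> expectation (\<lambda>\<omega>. log 2 (1 + G \<omega> * q))"
  then have "capacity.rate p \<le> capacity.rate q" by (simp add: capacity.rate_def)
  then show "p \<le> q" using capacity.rate_less[of q p] q assms by force
qed

text \<open>The curve is parametrized by the power itself, and its slope is the reciprocal of the
  slope of the capacity.\<close>

lemma superlinear_convex_rho_known_distribution: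
  "superlinear_convex (rho_known_distribution M G)"
proof (rule superlinear_convex_parametric[where S = capacity.rate and C = "\<lambda>p. p"
      and \<mu> = "\<lambda>p. ln 2 / marginal p"])
  show "continuous_on {0<..} (\<lambda>p. ln 2 / marginal p)"
    using marginal_pos by (intro continuous_intros continuous_on_marginal) force
  show "u + ln 2 / marginal u * (capacity.rate v - capacity.rate u) \<le> v" if "0 < u" "0 < v" for u v
  proof -
    have "ln 2 / marginal u * (capacity.rate v - capacity.rate u)
        \<le> ln 2 / marginal u * (marginal u / ln 2 * (v - u))"
      using capacity_tangent[OF that] marginal_pos[OF that(1)] by (intro mult_left_mono) auto
    also have "\<dots> = v - u" using marginal_pos[OF that(1)] by simp
    finally show ?thesis by simp
  qed
  show "ln 2 / marginal u < ln 2 / marginal v" if "0 < u" "u < v" for u v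
    using that marginal_less[OF that] marginal_pos[of v] by (intro divide_strict_left_mono) auto
  \<comment> \<open>By \<open>marginal_le\<close> the slope at \<open>u\<close> is at least
    \<open>u * ln 2\<close>.\<close>
  show "\<exists>u>0. 0 < capacity.rate u \<and> K < ln 2 / marginal u" for K
  proof -
    obtain u where u: "\<bar>K\<bar> / ln 2 < u" "0 < capacity.rate u" using capacity.rate_large by blast
    have u_pos: "0 < u" using u(1) by (smt (verit) divide_nonneg_pos ln_gt_zero)
    have "u * marginal u \<le> 1" using marginal_le[OF u_pos] u_pos by (simp add: field_simps)
    then have "u * ln 2 \<le> ln 2 / marginal u" using marginal_pos[OF u_pos] by (simp add: field_simps)
    moreover have "\<bar>K\<bar> < u * ln 2" using u(1) by (simp add: field_simps)
    ultimately show ?thesis using u_pos u(2) by (intro exI[of _ u]) auto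
  qed
qed (use capacity.continuous_on_rate capacity.rate_less capacity.rate_surj
    rho_known_distribution_rate in auto)

section \<open>Water filling: the transmitter knows the channel\<close>

sublocale waterfill: fading_rate M G "\<lambda>x. log 2 (max 1 x)"
proof
  fix x y :: real
  assume xy: "0 < x" "0 < y"
  \<comment> \<open>Here \<open>ln (max 1 x)\<close> is the positive part of \<open>ln x\<close>,
    and taking positive parts does not enlarge distances.\<close>
  have "\<bar>ln (max 1 x) - ln (max 1 y)\<bar> \<le> \<bar>ln x - ln y\<bar>"
    using xy ln_ge_zero_iff[of x] ln_ge_zero_iff[of y]
    by (auto simp: max_def abs_if)
  then show "\<bar>log 2 (max 1 x) - log 2 (max 1 y)\<bar> \<le> \<bar>log 2 x - log 2 y\<bar>"
    by (simp add: log_def divide_right_mono flip: diff_divide_distrib)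
qed (auto simp: max_def split: if_splits)

text \<open>
  For \<open>g > 0\<close> this is the water-filling power \<open>max 0 (u - 1/g)\<close> at water level \<open>u\<close>; division by
  zero makes it vanish at \<open>g = 0\<close>.
\<close>

definition water :: "real \<Rightarrow> real \<Rightarrow> real" where
  "water u g = max 0 (u * g - 1) / g"

definition water_power :: "real \<Rightarrow> real" where
  "water_power u = expectation (\<lambda>\<omega>. water u (G \<omega>))"

lemma water_measurable [measurable]: "water u \<in> borel_measurable borel"
  unfolding water_def by measurable

lemma water_nonneg: "0 \<le> g \<Longrightarrow> 0 \<le> water u g"
  by (simp add: water_def)

lemma water_le: "0 < u \<Longrightarrow> 0 \<le> g \<Longrightarrow> water u g \<le> u"
  by (cases "g = 0") (auto simp: water_def max_def field_simps)

lemma water_rate: "0 \<le> g \<Longrightarrow> 1 + g * water u g = max 1 (g * u)"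
  by (cases "g = 0") (auto simp: water_def max_def field_simps)

text \<open>
  The Lagrangian of the power allocation problem with multiplier \<open>u * ln 2\<close> is minimized
  pointwise, in every channel state \<open>g\<close>, by the water-filling power.
\<close>

lemma water_Lagrangian:
  assumes "0 < u" "0 \<le> g" "0 \<le> x"
  shows "water u g + u * ln 2 * log 2 (1 + g * x) \<le> x + u * ln 2 * log 2 (max 1 (g * u))"
proof -
  define m where "m = max 1 (g * u)"
  have m: "1 \<le> m" "g * u \<le> m" by (auto simp: m_def)
  have y: "0 < 1 + g * x" using assms by (simp add: add_pos_nonneg)
  \<comment> \<open>The tangent of \<open>ln\<close> is taken at the optimum, since
    \<open>m = 1 + g * water u g\<close>.\<close>
  have "ln ((1 + g * x) / m) \<le> (1 + g * x) / m - 1" using m y by (intro ln_le_minus_one) simp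
  also have "\<dots> = g * (x - water u g) / m"
    using m water_rate[OF assms(2), of u] by (simp add: m_def[symmetric] field_simps)
  finally have "u * (ln (1 + g * x) - ln m) \<le> u * (g * (x - water u g) / m)"
    using m y assms by (intro mult_left_mono) (auto simp: ln_div)
  \<comment> \<open>Complementary slackness: if the state receives water,
    \<open>u * g / m = 1\<close> and equality holds; otherwise the optimal power is 0 and
    \<open>g * u < 1\<close> suffices for \<open>x \<ge> 0\<close>.\<close>
  also have "\<dots> \<le> x - water u g"
  proof (cases "1 \<le> g * u")
    case True
    then have "m = u * g" by (simp add: m_def mult.commute)
    moreover have "u \<noteq> 0" "g \<noteq> 0" using True by auto
    ultimately show ?thesis by simp
  next
    case False
    then have "water u g = 0" "m = 1" by (auto simp: water_def m_def mult.commute)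
    then show ?thesis using False assms mult_right_mono[of "g * u" 1 x] by (simp add: mult_ac)
  qed
  finally show ?thesis by (simp add: log_def m_def algebra_simps)
qed

lemma water_integrable:
  assumes "0 < u"
  shows "integrable M (\<lambda>\<omega>. water u (G \<omega>))"
proof (rule integrable_const_bound[where B = u])
  show "AE \<omega> in M. norm (water u (G \<omega>)) \<le> u"
    using assms by (auto intro!: AE_I2 simp: G_nonneg water_nonneg water_le)
qed measurable

lemma water_power_nonneg: "0 \<le> water_power u"
  unfolding water_power_def by (intro Bochner_Integration.integral_nonneg water_nonneg G_nonneg)

text \<open>The expectation of \<open>water_Lagrangian\<close> with \<open>x\<close> the allocation
  at level \<open>v\<close>, whose rate is given by \<open>water_rate\<close>.\<close>

lemma water_power_tangent:
  assumes "0 < u" "0 < v"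
  shows "water_power u + u * ln 2 * (waterfill.rate v - waterfill.rate u) \<le> water_power v"
proof -
  have int: "integrable M (\<lambda>\<omega>. u * ln 2 * log 2 (max 1 (G \<omega> * v)))" if "0 < v" for v
    using waterfill.\<psi>_integrable[of v] that by (intro integrable_mult_right) auto
  have "expectation (\<lambda>\<omega>. water u (G \<omega>) + u * ln 2 * log 2 (max 1 (G \<omega> * v)))
      \<le> expectation (\<lambda>\<omega>. water v (G \<omega>) + u * ln 2 * log 2 (max 1 (G \<omega> * u)))"
  proof (intro integral_mono Bochner_Integration.integrable_add water_integrable int assms)
    fix \<omega> assume "\<omega> \<in> space M"
    then show "water u (G \<omega>) + u * ln 2 * log 2 (max 1 (G \<omega> * v))
        \<le> water v (G \<omega>) + u * ln 2 * log 2 (max 1 (G \<omega> * u))"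
      using water_Lagrangian[of u "G \<omega>" "water v (G \<omega>)"] assms
      by (simp add: G_nonneg water_nonneg water_rate)
  qed
  then show ?thesis
    using assms
    by (simp add: water_power_def waterfill.rate_def waterfill.\<psi>_integrable
        water_integrable right_diff_distrib)
qed

text \<open>Lagrangian duality against an arbitrary allocation. Since \<open>p\<close> may have
  infinite expected power or rate, the inequality is integrated in \<open>ennreal\<close>, arranged
  as sums without subtraction.\<close>

lemma water_power_le_nn_integral:
  assumes "0 < u" and p [measurable]: "p \<in> borel_measurable (restrict_space borel {0..})"
    and p_nonneg: "\<And>g. 0 \<le> g \<Longrightarrow> 0 \<le> p g"
    and rate: "ennreal (waterfill.rate u) \<le> (\<integral>\<^sup>+\<omega>. ennreal (log 2 (1 + G \<omega> * p (G \<omega>))) \<partial>M)"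
  shows "ennreal (water_power u) \<le> (\<integral>\<^sup>+\<omega>. ennreal (p (G \<omega>)) \<partial>M)"
proof -
  \<comment> \<open>\<open>p\<close> is measurable on the nonnegative half-line only, so
    \<open>G\<close> has to be viewed as a map into that subspace.\<close>
  have "G \<in> measurable M (restrict_space borel {0..})"
    using G_nonneg by (intro measurable_restrict_space2) auto
  then have pG [measurable]: "(\<lambda>\<omega>. p (G \<omega>)) \<in> borel_measurable M"
    by (rule measurable_compose) (rule p)
  define c where "c = u * ln 2"
  have c: "0 < c" using assms by (simp add: c_def)
  have logs: "0 \<le> log 2 (1 + G \<omega> * p (G \<omega>))" "0 \<le> log 2 (max 1 (G \<omega> * u))"
    if "\<omega> \<in> space M" for \<omega>
  proof -
    have "0 \<le> G \<omega> * p (G \<omega>)" using G_nonneg[OF that] p_nonneg[of "G \<omega>"] by simp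
    then show "0 \<le> log 2 (1 + G \<omega> * p (G \<omega>))" "0 \<le> log 2 (max 1 (G \<omega> * u))" by auto
  qed
  have int_rate: "(\<integral>\<^sup>+\<omega>. ennreal (log 2 (max 1 (G \<omega> * u))) \<partial>M) = ennreal (waterfill.rate u)"
    unfolding waterfill.rate_def using assms(1) logs
    by (intro nn_integral_eq_integral waterfill.\<psi>_integrable) (auto intro!: AE_I2)
  have int_water: "(\<integral>\<^sup>+\<omega>. ennreal (water u (G \<omega>)) \<partial>M) = ennreal (water_power u)"
    unfolding water_power_def using assms(1)
    by (intro nn_integral_eq_integral water_integrable) (auto intro!: AE_I2 water_nonneg G_nonneg)
  have "ennreal c * ennreal (waterfill.rate u) + ennreal (water_power u)
      \<le> ennreal c * (\<integral>\<^sup>+\<omega>. ennreal (log 2 (1 + G \<omega> * p (G \<omega>))) \<partial>M)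
        + (\<integral>\<^sup>+\<omega>. ennreal (water u (G \<omega>)) \<partial>M)"
    using rate by (intro add_mono mult_left_mono) (auto simp: int_water)
  also have "\<dots> = (\<integral>\<^sup>+\<omega>. ennreal c * ennreal (log 2 (1 + G \<omega> * p (G \<omega>))) + ennreal (water u (G \<omega>)) \<partial>M)"
    by (subst nn_integral_add) (auto simp: nn_integral_cmult)
  also have "\<dots> \<le> (\<integral>\<^sup>+\<omega>. ennreal c * ennreal (log 2 (max 1 (G \<omega> * u))) + ennreal (p (G \<omega>)) \<partial>M)"
  proof (rule nn_integral_mono)
    fix \<omega> assume \<omega>: "\<omega> \<in> space M"
    have "c * log 2 (1 + G \<omega> * p (G \<omega>)) + water u (G \<omega>) \<le> c * log 2 (max 1 (G \<omega> * u)) + p (G \<omega>)"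
      using water_Lagrangian[OF assms(1) G_nonneg[OF \<omega>] p_nonneg[OF G_nonneg[OF \<omega>]]]
      by (simp add: c_def)
    then show "ennreal c * ennreal (log 2 (1 + G \<omega> * p (G \<omega>))) + ennreal (water u (G \<omega>))
        \<le> ennreal c * ennreal (log 2 (max 1 (G \<omega> * u))) + ennreal (p (G \<omega>))"
      using c logs[OF \<omega>] G_nonneg[OF \<omega>] p_nonneg[of "G \<omega>"] water_nonneg[of "G \<omega>" u]
      by (simp add: ennreal_mult[symmetric] ennreal_plus[symmetric] ennreal_leI del: ennreal_plus)
  qed
  also have "\<dots> = ennreal c * ennreal (waterfill.rate u) + (\<integral>\<^sup>+\<omega>. ennreal (p (G \<omega>)) \<partial>M)"
    by (subst nn_integral_add) (auto simp: nn_integral_cmult int_rate)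
  \<comment> \<open>The common summand is the finite rate at level \<open>u\<close> times
    \<open>c\<close>, so it may be cancelled.\<close>
  finally show ?thesis
    by (simp add: ennreal_add_left_cancel_le ennreal_mult_eq_top_iff)
qed

lemma rho_known_channel_rate:
  assumes "0 < u"
  shows "rho_known_channel M G (waterfill.rate u) = water_power u"
proof -
  have "(LEAST e. \<exists>p \<in> borel_measurable (restrict_space borel {0..}).
       (\<forall>g\<ge>0. 0 \<le> p g) \<and>
       ennreal (waterfill.rate u) \<le> (\<integral>\<^sup>+\<omega>. ennreal (log 2 (1 + G \<omega> * p (G \<omega>))) \<partial>M) \<and>
       e = (\<integral>\<^sup>+\<omega>. ennreal (p (G \<omega>)) \<partial>M)) = ennreal (water_power u)"
  proof (rule Least_equality)
    have "(\<integral>\<^sup>+\<omega>. ennreal (log 2 (1 + G \<omega> * water u (G \<omega>))) \<partial>M)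
        = (\<integral>\<^sup>+\<omega>. ennreal (log 2 (max 1 (G \<omega> * u))) \<partial>M)"
      by (intro nn_integral_cong) (simp add: water_rate G_nonneg)
    also have "\<dots> = ennreal (waterfill.rate u)"
      unfolding waterfill.rate_def using assms
      by (intro nn_integral_eq_integral waterfill.\<psi>_integrable) (auto intro!: AE_I2)
    finally have "ennreal (waterfill.rate u)
        \<le> (\<integral>\<^sup>+\<omega>. ennreal (log 2 (1 + G \<omega> * water u (G \<omega>))) \<partial>M)"
      by simp
    moreover have "ennreal (water_power u) = (\<integral>\<^sup>+\<omega>. ennreal (water u (G \<omega>)) \<partial>M)"
      unfolding water_power_def using assms
      by (intro nn_integral_eq_integral[symmetric] water_integrable)
        (auto intro!: AE_I2 water_nonneg G_nonneg)
    moreover have "water u \<in> borel_measurable (restrict_space borel {0..})"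
      by (intro measurable_restrict_space1) measurable
    ultimately show "\<exists>p \<in> borel_measurable (restrict_space borel {0..}).
       (\<forall>g\<ge>0. 0 \<le> p g) \<and>
       ennreal (waterfill.rate u) \<le> (\<integral>\<^sup>+\<omega>. ennreal (log 2 (1 + G \<omega> * p (G \<omega>))) \<partial>M) \<and>
       ennreal (water_power u) = (\<integral>\<^sup>+\<omega>. ennreal (p (G \<omega>)) \<partial>M)"
      using water_nonneg by blast
  qed (use water_power_le_nn_integral[OF assms] in blast)
  then show ?thesis
    unfolding rho_known_channel_def by (simp add: water_power_nonneg)
qed

text \<open>The slope is the Lagrange multiplier \<open>u * ln 2\<close>, which grows without bound
  with the water level.\<close>

lemma superlinear_convex_rho_known_channel:
  "superlinear_convex (rho_known_channel M G)"
proof (rule superlinear_convex_parametric[where S = waterfill.rate and C = water_power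
      and \<mu> = "\<lambda>u. u * ln 2"])
  show "\<exists>u>0. 0 < waterfill.rate u \<and> K < u * ln 2" for K
  proof -
    obtain u where u: "\<bar>K\<bar> / ln 2 < u" "0 < waterfill.rate u" using waterfill.rate_large by blast
    then have "\<bar>K\<bar> < u * ln 2" by (simp add: field_simps)
    moreover have "0 < u" using u(1) by (smt (verit) divide_nonneg_pos ln_gt_zero)
    ultimately show ?thesis using u(2) by (intro exI[of _ u]) auto
  qed
qed (use waterfill.continuous_on_rate waterfill.rate_less waterfill.rate_surj
    rho_known_channel_rate water_power_nonneg water_power_tangent in
    \<open>auto intro!: continuous_intros\<close>)

end

section \<open>The three channel cases and the conclusion\<close>

lemma fading_channel_imp_fading:
  assumes "fading_channel M G"
  shows "fading M G"
proof -
  interpret prob_space M using assms by (simp add: fading_channel_def)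
  obtain f where f: "distributed M lborel G f" using assms by (auto simp: fading_channel_def)
  have G [measurable]: "G \<in> borel_measurable M"
    using distributed_measurable[OF f] by simp
  have "\<not> (AE \<omega> in M. G \<omega> = 0)"
  proof
    assume zero: "AE \<omega> in M. G \<omega> = 0"
    \<comment> \<open>A law with a density gives no mass to the point 0.\<close>
    have "AE x in distr M lborel G. x \<noteq> 0"
      unfolding distributed_distr_eq_density[OF f]
      using distributed_borel_measurable[OF f] AE_lborel_singleton[of 0]
      by (auto simp: AE_density)
    then have "AE \<omega> in M. G \<omega> \<noteq> 0" by (subst (asm) AE_distr_iff) auto
    with zero have "AE \<omega> in M. False" by eventually_elim simp
    then show False by simp
  qed
  then show ?thesis using assms by unfold_locales (auto simp: fading_channel_def)
qed

text \<open>Over a one-point probability space with constant gain, expectation is evaluation, and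
  the static minimum is literally the one for a known distribution.\<close>

lemma superlinear_convex_rho_static:
  assumes "0 < g"
  shows "superlinear_convex (rho_static g)"
proof -
  interpret one_point: prob_space "return (count_space UNIV) ()"
    by (rule prob_space_return) simp
  interpret fading "return (count_space UNIV) ()" "\<lambda>_. g"
    using assms by unfold_locales (auto simp: AE_return)
  have "rho_known_distribution (return (count_space UNIV) ()) (\<lambda>_. g) = rho_static g"
    using one_point.prob_space by (simp add: rho_known_distribution_def rho_static_def fun_eq_iff)
  then show ?thesis using superlinear_convex_rho_known_distribution by simp
qed

theorem theorem1:
  fixes B \<sigma>2 \<xi> Pc \<kappa> :: real
    and \<phi> \<rho> P :: "real \<Rightarrow> real"
    and \<E> :: "real \<Rightarrow> ereal"
    and M :: "'a measure" and G :: "'a \<Rightarrow> real"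
  assumes "0 < B" and "0 < \<sigma>2" and "0 < \<xi>" and "0 < Pc" and "0 \<le> \<kappa>"
    and "\<phi> 0 = 0" and "\<phi> differentiable_on {0..}"
    and "strict_mono_on {0..} \<phi>" and "convex_on {0..} \<phi>"
    and channel: "(\<exists>g>0. \<rho> = rho_static g) \<or>
      (fading_channel M G \<and> \<rho> = rho_known_distribution M G) \<or>
      (fading_channel M G \<and> \<rho> = rho_known_channel M G)"
    and P: "P = total_power \<kappa> \<phi> B \<sigma>2 \<xi> \<rho> Pc"
    and E: "\<E> = energy_per_bit B P"
  shows "(\<exists>!s. is_arg_min \<E> (\<lambda>s. 0 \<le> s) s) \<and>
    (\<forall>sopt. is_arg_min \<E> (\<lambda>s. 0 \<le> s) sopt \<longrightarrow>
      P differentiable at sopt \<and> deriv P sopt = P sopt / sopt \<and>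
      strict_antimono_on {0<..sopt} \<E> \<and>
      (\<forall>s\<in>{0<..<sopt}. P differentiable at s \<and> deriv P s < P s / s) \<and>
      strict_mono_on {sopt..} \<E> \<and>
      (\<forall>s\<in>{sopt<..}. P differentiable at s \<and> deriv P s > P s / s))"
proof -
  have \<rho>: "superlinear_convex \<rho>"
    using channel superlinear_convex_rho_static
      fading.superlinear_convex_rho_known_distribution[OF fading_channel_imp_fading]
      fading.superlinear_convex_rho_known_channel[OF fading_channel_imp_fading]
    by blast
  \<comment> \<open>Splitting off the circuit power supplies the positive constant that makes the
    energy per bit blow up near 0.\<close>
  have "P = (\<lambda>s. total_power \<kappa> \<phi> B \<sigma>2 \<xi> \<rho> 0 s + Pc)"
    by (simp add: P total_power_def fun_eq_iff)
  then show ?thesis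
    using assms \<rho>
    by (intro energy_per_bit_minimization[where f = "total_power \<kappa> \<phi> B \<sigma>2 \<xi> \<rho> 0"]
        superlinear_convex_total_power)
qed

end
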